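(* Let $A$ and $B$ be $n\times n$ positive definite matrices and let $0\le t\le 1$. For real $p\neq 0$ let $F_t(p)=\left((1-t)A^p+tB^p\right)^{1/p}$, and let $F_t(0)=\lim_{p\to 0}F_t(p)=e^{(1-t)\log A+t\log B}$. Then for each $1\le j\le n$ the function $p\mapsto \lambda_j(F_t(p))$ is an increasing function of $p$ on $(-\infty,\infty)$.
   Context: Matrices are $n\times n$ (complex), and positive definite matrices are Hermitian. Real powers and logarithms of positive definite matrices are defined by the usual functional calculus. For a Hermitian matrix $X$, $\lambda_1(X)\ge\cdots\ge\lambda_n(X)$ denote its eigenvalues in decreasing order, counted with multiplicity. "Increasing" means nondecreasing. It is a known fact (Bhagwat and Subramanian) that $\lim_{p\to0}\left((1-t)A^p+tB^p\right)^{1/p}=e^{(1-t)\log A+t\log B}$. *)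

theory Defs
  imports Complex_Main "Jordan_Normal_Form.Schur_Decomposition"
begin

definition hermitian_mat :: "complex mat \<Rightarrow> bool" where
  "hermitian_mat A \<longleftrightarrow> mat_adjoint A = A"

definition unitary_mat :: "complex mat \<Rightarrow> bool" where
  "unitary_mat U \<longleftrightarrow> square_mat U \<and> mat_adjoint U * U = 1\<^sub>m (dim_row U)"

text \<open>For Hermitian \<open>A\<close> the number \<open>v\<^sup>* A v\<close>, written \<open>(A *\<^sub>v v) \<bullet>c v\<close>, is automatically real.\<close>

definition pos_def_mat :: "complex mat \<Rightarrow> bool" where
  "pos_def_mat A \<longleftrightarrow> hermitian_mat A \<and>
     (\<forall>v \<in> carrier_vec (dim_row A). v \<noteq> 0\<^sub>v (dim_row A) \<longrightarrow> 0 < Re ((A *\<^sub>v v) \<bullet>c v))"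

definition unitary_diag :: "complex mat \<Rightarrow> complex mat \<Rightarrow> (nat \<Rightarrow> real) \<Rightarrow> bool" where
  "unitary_diag A U d \<longleftrightarrow> U \<in> carrier_mat (dim_row A) (dim_row A) \<and> unitary_mat U \<and>
     A = U * mat_diag (dim_row A) (\<lambda>i. complex_of_real (d i)) * mat_adjoint U"

text \<open>Functional calculus: \<open>f(A) = U diag(f(d\<^sub>i)) U\<^sup>*\<close> for any unitary diagonalization
  \<open>A = U diag(d\<^sub>i) U\<^sup>*\<close>. Such a diagonalization exists exactly when \<open>A\<close> is Hermitian; the result
  does not depend on its choice (lemma \<open>herm_fun_eq\<close> below), so the description is proper.\<close>

definition herm_fun :: "(real \<Rightarrow> real) \<Rightarrow> complex mat \<Rightarrow> complex mat" where
  "herm_fun f A = (THE C. \<exists>U d. unitary_diag A U d \<and>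
     C = U * mat_diag (dim_row A) (\<lambda>i. complex_of_real (f (d i))) * mat_adjoint U)"

abbreviation mat_rpow :: "complex mat \<Rightarrow> real \<Rightarrow> complex mat" where
  "mat_rpow A p \<equiv> herm_fun (\<lambda>x. x powr p) A"

abbreviation mat_log :: "complex mat \<Rightarrow> complex mat" where
  "mat_log A \<equiv> herm_fun ln A"

abbreviation mat_exp :: "complex mat \<Rightarrow> complex mat" where
  "mat_exp A \<equiv> herm_fun exp A"

text \<open>At \<open>p = 0\<close> the value is the explicit form of the limit of the means as \<open>p \<rightarrow> 0\<close>.\<close>

definition matrix_mean :: "real \<Rightarrow> complex mat \<Rightarrow> complex mat \<Rightarrow> real \<Rightarrow> complex mat" where
  "matrix_mean t A B p =
     (if p = 0
      then mat_exp (complex_of_real (1 - t) \<cdot>\<^sub>m mat_log A + complex_of_real t \<cdot>\<^sub>m mat_log B)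
      else mat_rpow (complex_of_real (1 - t) \<cdot>\<^sub>m mat_rpow A p
             + complex_of_real t \<cdot>\<^sub>m mat_rpow B p) (1 / p))"

text \<open>Eigenvalues of a Hermitian matrix in decreasing order. \<open>proots\<close> counts roots of the
  characteristic polynomial with multiplicity; they are real, so \<open>Re\<close> only changes the type.
  \<open>herm_eigval X j\<close> is \<open>\<lambda>\<^sub>j(X)\<close>, indexed from 1.\<close>

definition herm_eigvals :: "complex mat \<Rightarrow> real list" where
  "herm_eigvals X = rev (sorted_list_of_multiset (image_mset Re (proots (char_poly X))))"

definition herm_eigval :: "complex mat \<Rightarrow> nat \<Rightarrow> real" where
  "herm_eigval X j = herm_eigvals X ! (j - 1)"

lemma mat_adjoint_carrier [simp]:
  "A \<in> carrier_mat m n \<Longrightarrow> mat_adjoint A \<in> carrier_mat n m"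
  by (auto simp: mat_adjoint_def)

lemma unitary_mat_right_inverse:
  assumes "U \<in> carrier_mat n n" "unitary_mat U"
  shows "U * mat_adjoint U = 1\<^sub>m n" "mat_adjoint U * U = 1\<^sub>m n"
proof -
  show *: "mat_adjoint U * U = 1\<^sub>m n" using assms by (auto simp: unitary_mat_def)
  show "U * mat_adjoint U = 1\<^sub>m n"
    by (rule mat_mult_left_right_inverse[OF _ _ *]) (use assms in auto)
qed

lemma unitary_diag_fun_unique:
  assumes U: "unitary_diag A U d" and V: "unitary_diag A V e"
  shows "U * mat_diag (dim_row A) (\<lambda>i. complex_of_real (f (d i))) * mat_adjoint U
       = V * mat_diag (dim_row A) (\<lambda>i. complex_of_real (f (e i))) * mat_adjoint V"
proof -
  define n where "n = dim_row A"
  define D where "D = (\<lambda>g :: real \<Rightarrow> real. mat_diag n (\<lambda>i. complex_of_real (g (d i))))"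
  define E where "E = (\<lambda>g :: real \<Rightarrow> real. mat_diag n (\<lambda>i. complex_of_real (g (e i))))"
  define W where "W = mat_adjoint V * U"
  have c [simp]: "U \<in> carrier_mat n n" "V \<in> carrier_mat n n"
    "mat_adjoint U \<in> carrier_mat n n" "mat_adjoint V \<in> carrier_mat n n"
    "\<And>g. D g \<in> carrier_mat n n" "\<And>g. E g \<in> carrier_mat n n" "W \<in> carrier_mat n n"
    using U V by (auto simp: unitary_diag_def n_def D_def E_def W_def intro!: mult_carrier_mat)
  have uU: "U * mat_adjoint U = 1\<^sub>m n" "mat_adjoint U * U = 1\<^sub>m n"
    using U unitary_mat_right_inverse[of U n] by (auto simp: unitary_diag_def n_def)
  have uV: "V * mat_adjoint V = 1\<^sub>m n" "mat_adjoint V * V = 1\<^sub>m n"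
    using V unitary_mat_right_inverse[of V n] by (auto simp: unitary_diag_def n_def)
  have AU: "A = U * D (\<lambda>x. x) * mat_adjoint U" and AV: "A = V * E (\<lambda>x. x) * mat_adjoint V"
    using U V by (auto simp: unitary_diag_def n_def D_def E_def)
  note assoc = assoc_mult_mat[of _ n n _ n _ n]
  have cl: "\<And>X Y. X \<in> carrier_mat n n \<Longrightarrow> Y \<in> carrier_mat n n \<Longrightarrow> X * Y \<in> carrier_mat n n"
    by auto
  have one [simp]: "1\<^sub>m n * X = X" "X * 1\<^sub>m n = X" if "X \<in> carrier_mat n n" for X :: "complex mat"
    using that by auto
  have VWg: "V * W = U"
    using uV assoc[of V "mat_adjoint V" U] by (simp add: W_def)
  have WD: "W * D (\<lambda>x. x) = E (\<lambda>x. x) * W"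
  proof -
    have "W * D (\<lambda>x. x) = mat_adjoint V * (U * D (\<lambda>x. x) * (mat_adjoint U * U))"
      by (simp add: W_def uU assoc cl)
    also have "\<dots> = mat_adjoint V * (A * U)"
      by (simp add: AU assoc cl)
    also have "\<dots> = (mat_adjoint V * V) * (E (\<lambda>x. x) * (mat_adjoint V * U))"
      by (subst AV) (simp add: assoc cl)
    also have "\<dots> = E (\<lambda>x. x) * W"
      by (simp add: uV W_def cl)
    finally show ?thesis .
  qed
  have "W * D f = E f * W"
  proof (rule eq_matI)
    fix i j assume ij: "i < dim_row (E f * W)" "j < dim_col (E f * W)"
    then have ij: "i < n" "j < n"
      using carrier_matD[OF c(6)[of f]] carrier_matD[OF c(7)] by auto
    have wd: "(W * D g) $$ (i,j) = W $$ (i,j) * g (d j)" for g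
      using ij by (simp add: D_def mat_diag_mult_right[of _ n])
    have ew: "(E g * W) $$ (i,j) = g (e i) * W $$ (i,j)" for g
      using ij by (simp add: E_def mat_diag_mult_left[of _ n n])
    have "W $$ (i,j) * d j = e i * W $$ (i,j)"
      using arg_cong[OF WD, of "\<lambda>M. M $$ (i,j)"] by (simp only: wd ew)
    then have "W $$ (i,j) = 0 \<or> d j = e i"
      by auto
    then show "(W * D f) $$ (i,j) = (E f * W) $$ (i,j)"
      unfolding wd ew by auto
  qed (use carrier_matD[OF c(5)[of f]] carrier_matD[OF c(6)[of f]] carrier_matD[OF c(7)] in auto)
  then have "V * (W * D f) * mat_adjoint U = V * (E f * W) * mat_adjoint U" by simp
  moreover have "V * (W * D f) * mat_adjoint U = U * D f * mat_adjoint U"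
    using assoc[of V W "D f"] by (simp add: VWg)
  moreover have "V * (E f * W) * mat_adjoint U = V * E f * mat_adjoint V"
  proof -
    have "V * (E f * W) * mat_adjoint U = V * E f * (mat_adjoint V * (U * mat_adjoint U))"
      by (simp add: W_def assoc cl)
    then show ?thesis by (simp add: uU)
  qed
  ultimately show ?thesis by (simp add: D_def E_def n_def)
qed

lemma herm_fun_eq:
  assumes "unitary_diag A U d"
  shows "herm_fun f A
    = U * mat_diag (dim_row A) (\<lambda>i. complex_of_real (f (d i))) * mat_adjoint U"
  unfolding herm_fun_def
  by (rule the_equality) (use assms unitary_diag_fun_unique in blast)+

end

(*
  For p = r q with 0 < r < 1, operator concavity of x^r gives
  (1-t) A^p + t B^p <= ((1-t) A^q + t B^q)^r in the Loewner order. Weyl's monotonicity principle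
  turns this into inequalities between the j-th largest eigenvalues, and applying the scalar map
  x |-> x^(1/p) to them yields the claim for exponents of equal sign (for negative exponents this map
  is decreasing and the eigenvalue index is reversed, which restores the direction). The exponent 0
  is compared with any q through operator concavity of the logarithm in the same way, so the limit
  formula for p -> 0 is not needed.

  Concavity reduces to that of the resolvents x / (x + s): this is operator convexity of the
  inverse, i.e. the variational formula <v, X^-1 v> = max_w (2 Re <v, w> - <w, X w>). Then x^r is an
  integral of resolvents over s, and ln x is the limit of (x^r - 1) / r as r -> 0.
*)
theory Submission
  imports "HOL-Analysis.Equivalence_Lebesgue_Henstock_Integration"
    "HOL-Computational_Algebra.Fundamental_Theorem_Algebra" Defs
begin

unbundle no vec_syntax
hide_const (open) Finite_Cartesian_Product.vec
hide_type (open) Finite_Cartesian_Product.vec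

section \<open>Adjoints and quadratic forms\<close>

lemma mat_adjoint_dim [simp]:
  "dim_row (mat_adjoint M) = dim_col M" "dim_col (mat_adjoint M) = dim_row M"
  by (auto simp: mat_adjoint_def)

lemma mat_adjoint_index [simp]:
  fixes M :: "complex mat"
  shows "i < dim_col M \<Longrightarrow> j < dim_row M \<Longrightarrow> mat_adjoint M $$ (i, j) = cnj (M $$ (j, i))"
  by (auto simp: mat_adjoint_def mat_of_rows_index)

lemma mat_adjoint_mult:
  fixes M N :: "complex mat"
  assumes "M \<in> carrier_mat m n" "N \<in> carrier_mat n k"
  shows "mat_adjoint (M * N) = mat_adjoint N * mat_adjoint M"
proof (rule eq_matI)
  fix i j assume "i < dim_row (mat_adjoint N * mat_adjoint M)" "j < dim_col (mat_adjoint N * mat_adjoint M)"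
  then have ij: "i < k" "j < m" using assms by auto
  then show "mat_adjoint (M * N) $$ (i, j) = (mat_adjoint N * mat_adjoint M) $$ (i, j)"
    using assms by (simp add: scalar_prod_def mult.commute)
qed (use assms in auto)

lemma mat_adjoint_adjoint [simp]:
  fixes M :: "complex mat"
  shows "mat_adjoint (mat_adjoint M) = M"
  by (rule eq_matI) auto

lemma mat_adjoint_add:
  fixes M N :: "complex mat"
  assumes "M \<in> carrier_mat m n" "N \<in> carrier_mat m n"
  shows "mat_adjoint (M + N) = mat_adjoint M + mat_adjoint N"
  using assms by (intro eq_matI) auto

lemma mat_adjoint_smult:
  fixes M :: "complex mat"
  shows "mat_adjoint (c \<cdot>\<^sub>m M) = cnj c \<cdot>\<^sub>m mat_adjoint M"
  by (intro eq_matI) auto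

lemma mat_adjoint_diag_real:
  "mat_adjoint (mat_diag n (\<lambda>i. complex_of_real (d i))) = mat_diag n (\<lambda>i. complex_of_real (d i))"
  by (intro eq_matI) (auto simp: mat_diag_def)

section \<open>Sesquilinear forms in the coordinates of an orthonormal basis\<close>

lemma mult_mat_vec_cscalar_prod:
  fixes M :: "complex mat"
  assumes M: "M \<in> carrier_mat m n" and v: "v \<in> carrier_vec n" and w: "w \<in> carrier_vec m"
  shows "(M *\<^sub>v v) \<bullet>c w = v \<bullet>c (mat_adjoint M *\<^sub>v w)"
proof -
  have "(M *\<^sub>v v) \<bullet>c w = (\<Sum>i<m. \<Sum>j<n. M $$ (i,j) * v $ j * cnj (w $ i))"
    using M v w by (auto simp: scalar_prod_def lessThan_atLeast0 sum_distrib_right)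
  also have "\<dots> = (\<Sum>j<n. \<Sum>i<m. M $$ (i,j) * v $ j * cnj (w $ i))"
    by (rule sum.swap)
  also have "\<dots> = v \<bullet>c (mat_adjoint M *\<^sub>v w)"
    using M v w
    by (auto simp: scalar_prod_def lessThan_atLeast0 sum_distrib_left mult_ac intro!: sum.cong)
  finally show ?thesis .
qed

lemma mat_diag_mult_vec:
  fixes x :: "'a :: comm_semiring_1 Matrix.vec"
  assumes "x \<in> carrier_vec n"
  shows "mat_diag n f *\<^sub>v x = Matrix.vec n (\<lambda>i. f i * x $ i)"
proof (rule eq_vecI)
  fix i assume "i < dim_vec (Matrix.vec n (\<lambda>i. f i * x $ i))"
  then have i: "i < n" by simp
  have "(mat_diag n f *\<^sub>v x) $ i = (\<Sum>j<n. (if i = j then f j else 0) * x $ j)"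
    using i assms by (simp add: scalar_prod_def mat_diag_def lessThan_atLeast0)
  also have "\<dots> = (\<Sum>j<n. if j = i then f j * x $ j else 0)"
    by (intro sum.cong) auto
  finally show "(mat_diag n f *\<^sub>v x) $ i = Matrix.vec n (\<lambda>i. f i * x $ i) $ i"
    using i by simp
qed (simp add: mat_diag_def)

text \<open>For unitary \<open>U\<close> this is the coordinate of \<open>v\<close> along the
  \<open>i\<close>-th column of \<open>U\<close>, in the orthonormal basis formed by the
  columns.\<close>

definition coord :: "complex mat \<Rightarrow> complex vec \<Rightarrow> nat \<Rightarrow> complex" where
  "coord U v i = (mat_adjoint U *\<^sub>v v) $ i"

text \<open>The value at \<open>v\<close> of the quadratic form of \<open>U diag(d\<^sub>0, \<dots>) U\<^sup>*\<close>.\<close>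

definition diag_form :: "complex mat \<Rightarrow> (nat \<Rightarrow> real) \<Rightarrow> complex vec \<Rightarrow> real" where
  "diag_form U d v = (\<Sum>i<dim_col U. d i * (cmod (coord U v i))\<^sup>2)"

text \<open>Moving the outer factor \<open>U\<close> to the other side as its adjoint leaves only
  the diagonal factor between the two coordinate vectors.\<close>

lemma unitary_diag_sesquilinear:
  assumes A: "A \<in> carrier_mat n n" and U: "unitary_diag A U d"
    and v: "v \<in> carrier_vec n" and w: "w \<in> carrier_vec n"
  shows "(A *\<^sub>v v) \<bullet>c w = (\<Sum>i<n. of_real (d i) * (coord U v i * cnj (coord U w i)))"
proof -
  let ?D = "mat_diag n (\<lambda>i. complex_of_real (d i))"
  have Uc: "U \<in> carrier_mat n n" and AU: "A = U * ?D * mat_adjoint U"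
    using A U by (auto simp: unitary_diag_def)
  have Uc': "mat_adjoint U \<in> carrier_mat n n" using Uc by simp
  have vc: "mat_adjoint U *\<^sub>v v \<in> carrier_vec n" using Uc' v by auto
  have wc: "mat_adjoint U *\<^sub>v w \<in> carrier_vec n" using Uc' w by auto
  have D: "?D \<in> carrier_mat n n" by simp
  have "A *\<^sub>v v = U *\<^sub>v (?D *\<^sub>v (mat_adjoint U *\<^sub>v v))"
    unfolding AU using Uc Uc' v D vc by (simp add: assoc_mult_mat_vec[of _ n n _ n] mult_carrier_mat)
  then have "(A *\<^sub>v v) \<bullet>c w = (?D *\<^sub>v (mat_adjoint U *\<^sub>v v)) \<bullet>c (mat_adjoint U *\<^sub>v w)"
    using mult_mat_vec_cscalar_prod[OF Uc mult_mat_vec_carrier[OF D vc] w] by simp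
  also have "?D *\<^sub>v (mat_adjoint U *\<^sub>v v) = Matrix.vec n (\<lambda>i. of_real (d i) * coord U v i)"
    unfolding mat_diag_mult_vec[OF vc] coord_def ..
  also have "\<dots> \<bullet>c (mat_adjoint U *\<^sub>v w) = (\<Sum>i<n. of_real (d i) * (coord U v i * cnj (coord U w i)))"
    using wc Uc by (simp add: scalar_prod_def[of "Matrix.vec _ _"] coord_def lessThan_atLeast0 mult.assoc
        del: index_mult_mat_vec)
  finally show ?thesis .
qed

lemma diag_form_eq:
  assumes A: "A \<in> carrier_mat n n" and U: "unitary_diag A U d" and v: "v \<in> carrier_vec n"
  shows "Re ((A *\<^sub>v v) \<bullet>c v) = diag_form U d v"
proof -
  have "dim_col U = n" using A U by (auto simp: unitary_diag_def)
  then show ?thesis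
    unfolding unitary_diag_sesquilinear[OF A U v v] diag_form_def
    by (simp add: complex_norm_square[symmetric] flip: of_real_power)
qed

text \<open>Makes Parseval's identity the special case of the spectral formula for the identity
  matrix.\<close>

lemma unitary_diag_one:
  assumes "U \<in> carrier_mat n n" "unitary_mat U"
  shows "unitary_diag (1\<^sub>m n) U (\<lambda>_. 1)"
  using assms unitary_mat_right_inverse[OF assms] by (auto simp: unitary_diag_def)

lemma parseval:
  assumes "U \<in> carrier_mat n n" "unitary_mat U" "v \<in> carrier_vec n" "w \<in> carrier_vec n"
  shows "v \<bullet>c w = (\<Sum>i<n. coord U v i * cnj (coord U w i))"
  using unitary_diag_sesquilinear[OF _ unitary_diag_one[OF assms(1,2)] assms(3,4)] assms by simp

lemma coord_unitary:
  assumes U: "U \<in> carrier_mat n n" "unitary_mat U" and f: "i < n"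
  shows "coord U (U *\<^sub>v Matrix.vec n f) i = f i"
proof -
  have "mat_adjoint U *\<^sub>v (U *\<^sub>v Matrix.vec n f) = Matrix.vec n f"
    using U unitary_mat_right_inverse[OF U]
    by (simp add: assoc_mult_mat_vec[symmetric, of _ n n _ n])
  then show ?thesis using f by (simp add: coord_def)
qed

lemma vec_eq_0_if_coord_eq_0:
  assumes U: "U \<in> carrier_mat n n" "unitary_mat U" and v: "v \<in> carrier_vec n"
    and 0: "\<And>i. i < n \<Longrightarrow> coord U v i = 0"
  shows "v = 0\<^sub>v n"
proof -
  have "v \<bullet>c v = 0" using parseval[OF U v v] 0 by simp
  then show ?thesis using conjugate_square_eq_0_vec[OF v] by simp
qed

text \<open>Testing with the \<open>i\<close>-th column of \<open>U\<close> isolates the entry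
  \<open>d i\<close>. Conversely, a nonzero vector has a nonzero coordinate, which contributes a
  positive term to a sum of nonnegative ones.\<close>

lemma diag_form_pos_iff:
  assumes U: "U \<in> carrier_mat n n" "unitary_mat U"
  shows "(\<forall>v\<in>carrier_vec n. v \<noteq> 0\<^sub>v n \<longrightarrow> 0 < diag_form U d v) \<longleftrightarrow> (\<forall>i<n. 0 < d i)"
proof safe
  fix i assume pos: "\<forall>v\<in>carrier_vec n. v \<noteq> 0\<^sub>v n \<longrightarrow> 0 < diag_form U d v" and i: "i < n"
  define v where "v = U *\<^sub>v Matrix.vec n (\<lambda>k. if k = i then 1 else 0)"
  have c: "coord U v k = (if k = i then 1 else 0)" if "k < n" for k
    unfolding v_def by (rule coord_unitary[OF U that])
  have v: "v \<in> carrier_vec n" using U by (simp add: v_def)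
  have "v \<noteq> 0\<^sub>v n"
    using c[OF i] U i by (auto simp: coord_def)
  moreover have "diag_form U d v = (\<Sum>k<n. if k = i then d k else 0)"
    unfolding diag_form_def using U by (intro sum.cong) (auto simp: c)
  ultimately show "0 < d i" using bspec[OF pos v] i by simp
next
  fix v :: "complex Matrix.vec" assume d: "\<forall>i<n. 0 < d i" and v: "v \<in> carrier_vec n" "v \<noteq> 0\<^sub>v n"
  then obtain i where i: "i < n" "coord U v i \<noteq> 0" using vec_eq_0_if_coord_eq_0[OF U v(1)] by auto
  have "0 < d i * (cmod (coord U v i))\<^sup>2" using d i by simp
  also have "\<dots> \<le> (\<Sum>i<n. d i * (cmod (coord U v i))\<^sup>2)"
    using d i by (intro member_le_sum) (auto intro: less_imp_le)
  finally show "0 < diag_form U d v" using U by (simp add: diag_form_def)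
qed

section \<open>Positivity and functional calculus in terms of a diagonalization\<close>

lemma pos_def_mat_iff:
  assumes A: "A \<in> carrier_mat n n" and U: "unitary_diag A U d"
  shows "pos_def_mat A \<longleftrightarrow> hermitian_mat A \<and> (\<forall>i<n. 0 < d i)"
proof -
  have U': "U \<in> carrier_mat n n" "unitary_mat U" using A U by (auto simp: unitary_diag_def)
  show ?thesis
    unfolding diag_form_pos_iff[OF U', symmetric] pos_def_mat_def
    using A diag_form_eq[OF A U] by auto
qed

lemma hermitian_if_unitary_diag:
  assumes A: "A \<in> carrier_mat n n" and U: "unitary_diag A U d"
  shows "hermitian_mat A"
proof -
  let ?D = "mat_diag n (\<lambda>i. complex_of_real (d i))"
  have Uc: "U \<in> carrier_mat n n" and AU: "A = U * ?D * mat_adjoint U"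
    using A U by (auto simp: unitary_diag_def)
  have [simp]: "U * ?D \<in> carrier_mat n n" using Uc by auto
  have "mat_adjoint A = U * (?D * mat_adjoint U)"
    unfolding AU using Uc
    by (simp add: mat_adjoint_mult[of _ n n _ n] mat_adjoint_diag_real)
  also have "\<dots> = A" unfolding AU using Uc by (simp add: assoc_mult_mat[of _ n n _ n _ n])
  finally show ?thesis by (simp add: hermitian_mat_def)
qed

lemma herm_fun_carrier:
  assumes A: "A \<in> carrier_mat n n" and U: "unitary_diag A U d"
  shows "herm_fun f A \<in> carrier_mat n n"
proof -
  have "U \<in> carrier_mat n n" using A U by (simp add: unitary_diag_def)
  then show ?thesis
    using A unfolding herm_fun_eq[OF U] by (intro mult_carrier_mat[of _ n n]) auto
qed

text \<open>The same \<open>U\<close> serves for every \<open>f\<close>, so iterated functional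
  calculus becomes composition of functions on the eigenvalues.\<close>

lemma unitary_diag_herm_fun:
  assumes A: "A \<in> carrier_mat n n" and U: "unitary_diag A U d"
  shows "unitary_diag (herm_fun f A) U (\<lambda>i. f (d i))"
  using A U carrier_matD[OF herm_fun_carrier[OF A U]] herm_fun_eq[OF U]
  unfolding unitary_diag_def by auto

section \<open>Unitary diagonalization\<close>

lemma mat_adjoint_mult_index:
  fixes W :: "complex mat"
  assumes "i < dim_col W" "dim_row X = dim_row W" "j < dim_col X"
  shows "(mat_adjoint W * X) $$ (i, j) = col X j \<bullet>c col W i"
  using assms by (simp add: scalar_prod_def mult.commute)

lemma unitary_mat_mult:
  assumes U: "U \<in> carrier_mat n n" "unitary_mat U" and V: "V \<in> carrier_mat n n" "unitary_mat V"
  shows "unitary_mat (U * V)"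
proof -
  have "mat_adjoint (U * V) * (U * V) = mat_adjoint V * ((mat_adjoint U * U) * V)"
    using U V by (simp add: mat_adjoint_mult[of _ n n _ n] assoc_mult_mat[of _ n n _ n _ n]
        mult_carrier_mat[of _ n n])
  also have "\<dots> = 1\<^sub>m n"
    using V unitary_mat_right_inverse[OF U] unitary_mat_right_inverse[OF V] by simp
  finally show ?thesis using U V by (simp add: unitary_mat_def square_mat.simps)
qed

lemma unitary_diag_conjugate:
  assumes A: "A \<in> carrier_mat n n" and W: "W \<in> carrier_mat n n" "unitary_mat W"
    and d: "unitary_diag (mat_adjoint W * A * W) F d"
  shows "unitary_diag A (W * F) d"
proof -
  let ?D = "mat_diag n (\<lambda>i. complex_of_real (d i))"
  have F: "F \<in> carrier_mat n n" "unitary_mat F"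
    and eq: "mat_adjoint W * A * W = F * ?D * mat_adjoint F"
    using d W by (auto simp: unitary_diag_def)
  have cl: "X * Y \<in> carrier_mat n n" if "X \<in> carrier_mat n n" "Y \<in> carrier_mat n n" for X Y :: "complex mat"
    using that by simp
  note assoc = assoc_mult_mat[of _ n n _ n _ n]
  have "A = (W * mat_adjoint W) * A * (W * mat_adjoint W)"
    using A unitary_mat_right_inverse[OF W] by simp
  also have "\<dots> = W * (mat_adjoint W * A * W) * mat_adjoint W"
    using A W by (simp add: assoc cl)
  also have "\<dots> = W * F * ?D * mat_adjoint (W * F)"
    unfolding eq using W F by (simp add: assoc cl mat_adjoint_mult[of _ n n _ n])
  finally have "A = W * F * ?D * mat_adjoint (W * F)" .
  then show ?thesis
    using A W F by (simp add: unitary_diag_def unitary_mat_mult[OF W F] cl)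
qed

text \<open>A basis beginning with \<open>v\<close> is orthogonalised by Gram-Schmidt, which keeps
  its first vector; normalising the result makes the first column a multiple of
  \<open>v\<close>.\<close>

lemma vec_extends_to_unitary:
  fixes v :: "complex Matrix.vec"
  assumes v: "v \<in> carrier_vec n" "v \<noteq> 0\<^sub>v n"
  obtains W s where "W \<in> carrier_mat n n" "unitary_mat W" "col W 0 = s \<cdot>\<^sub>v v"
proof -
  interpret cof_vec_space n "TYPE(complex)" .
  define b where "b = basis_completion v"
  note b = basis_completion[OF v, folded b_def]
  define ws where "ws = gram_schmidt n b"
  have ws: "corthogonal ws" "set ws \<subseteq> carrier_vec n" "length ws = n"
    using gram_schmidt_result[OF b(2) b(4) b(5) ws_def] b(6) by auto
  have n: "0 < n" using v by (cases n) auto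
  obtain vs where "b = v # vs" using b(6,7) n by (cases b) auto
  then have "hd ws = v" using gram_schmidt_hd[OF v(1), of vs] by (simp add: ws_def)
  then have hd: "ws ! 0 = v" using ws(3) n by (cases ws) auto
  \<comment> \<open>The reciprocal of the norm of \<open>w\<close>.\<close>
  define s where "s = (\<lambda>w :: complex Matrix.vec. complex_of_real (1 / sqrt (Re (w \<bullet>c w))))"
  define W where "W = mat_of_cols n (map (\<lambda>w. s w \<cdot>\<^sub>v w) ws)"
  have W: "W \<in> carrier_mat n n" 
    using mat_of_cols_carrier(1)[of n "map (\<lambda>w. s w \<cdot>\<^sub>v w) ws"] ws(3) by (simp add: W_def)
  have wsi: "ws ! i \<in> carrier_vec n" if "i < n" for i using ws that by auto
  have col: "col W i = s (ws ! i) \<cdot>\<^sub>v (ws ! i)" if "i < n" for i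
    unfolding W_def using that ws wsi by simp
  have "mat_adjoint W * W = 1\<^sub>m n"
  proof (rule eq_matI)
    fix i j assume "i < dim_row (1\<^sub>m n :: complex mat)" "j < dim_col (1\<^sub>m n :: complex mat)"
    then have ij: "i < n" "j < n" by auto
    have "(mat_adjoint W * W) $$ (i, j) = s (ws ! j) * cnj (s (ws ! i)) * (ws ! j \<bullet>c ws ! i)"
      using ij W wsi
      by (subst mat_adjoint_mult_index) (auto simp: col conjugate_smult_vec
          smult_scalar_prod_distrib[of _ n] scalar_prod_smult_distrib[of _ n])
    also have "\<dots> = (if i = j then 1 else 0)"
    proof (cases "i = j")
      case True
      let ?w = "ws ! i"
      \<comment> \<open>\<open>corthogonal\<close> also says that no member is orthogonal to itself,
        so the norm in the denominator is nonzero.\<close>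
      have pos: "?w \<bullet>c ?w > 0" using corthogonalD[OF ws(1), of i i] ws(3) ij
          conjugate_square_ge_0_vec[of ?w] by auto
      then have w: "Re (?w \<bullet>c ?w) > 0" "?w \<bullet>c ?w = of_real (Re (?w \<bullet>c ?w))"
        by (auto simp: less_complex_def complex_eq_iff)
      have "s ?w * cnj (s ?w) = of_real (1 / Re (?w \<bullet>c ?w))"
        using w(1) unfolding s_def complex_cnj_complex_of_real of_real_mult[symmetric]
        by (simp add: real_sqrt_mult_self)
      then have "s ?w * cnj (s ?w) * (?w \<bullet>c ?w) = of_real (1 / Re (?w \<bullet>c ?w) * Re (?w \<bullet>c ?w))"
        unfolding of_real_mult using w(2) by metis
      then show ?thesis using True w(1) by simp
    next
      case False
      then show ?thesis using corthogonalD[OF ws(1), of j i] ws(3) ij by auto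
    qed
    finally show "(mat_adjoint W * W) $$ (i, j) = 1\<^sub>m n $$ (i, j)" using ij by simp
  qed (use W in auto)
  then have "unitary_mat W" using W by (simp add: unitary_mat_def square_mat.simps)
  moreover have "col W 0 = s v \<cdot>\<^sub>v v" using col[OF n] hd by simp
  ultimately show thesis using that W by blast
qed

text \<open>Block diagonal matrices multiply block by block, so a diagonalization of
  \<open>B\<close> extends by the eigenvalue \<open>e\<close> at index 0.\<close>

lemma unitary_diag_four_block:
  assumes B: "B \<in> carrier_mat m m" and U: "unitary_diag B U d"
  shows "unitary_diag (four_block_mat (mat 1 1 (\<lambda>_. complex_of_real e)) (0\<^sub>m 1 m) (0\<^sub>m m 1) B)
    (four_block_mat (1\<^sub>m 1) (0\<^sub>m 1 m) (0\<^sub>m m 1) U) (\<lambda>i. case i of 0 \<Rightarrow> e | Suc k \<Rightarrow> d k)"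
    (is "unitary_diag ?A ?F ?d")
proof -
  let ?D = "mat_diag m (\<lambda>i. complex_of_real (d i))"
  let ?E = "mat 1 1 (\<lambda>_. complex_of_real e)"
  have Uc: "U \<in> carrier_mat m m" "unitary_mat U" and BU: "B = U * ?D * mat_adjoint U"
    using B U by (auto simp: unitary_diag_def)
  have F: "?F \<in> carrier_mat (Suc m) (Suc m)" 
    using four_block_carrier_mat[OF one_carrier_mat[of 1] Uc(1)] by simp
  have adj: "mat_adjoint ?F = four_block_mat (1\<^sub>m 1) (0\<^sub>m 1 m) (0\<^sub>m m 1) (mat_adjoint U)"
    using Uc by (intro eq_matI) auto
  have D: "mat_diag (Suc m) (\<lambda>i. complex_of_real (?d i)) = four_block_mat ?E (0\<^sub>m 1 m) (0\<^sub>m m 1) ?D"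
    by (intro eq_matI) (auto simp: mat_diag_def split: nat.splits)
  have mult: "four_block_mat X (0\<^sub>m 1 m) (0\<^sub>m m 1) Y * four_block_mat X' (0\<^sub>m 1 m) (0\<^sub>m m 1) Y'
      = four_block_mat (X * X') (0\<^sub>m 1 m) (0\<^sub>m m 1) (Y * Y')"
    if "X \<in> carrier_mat 1 1" "X' \<in> carrier_mat 1 1" "Y \<in> carrier_mat m m" "Y' \<in> carrier_mat m m"
    for X X' Y Y' :: "complex mat"
    using mult_four_block_mat[OF that(1) zero_carrier_mat zero_carrier_mat that(3)
        that(2) zero_carrier_mat zero_carrier_mat that(4)] that
    by simp
  have "mat_adjoint ?F * ?F = four_block_mat (1\<^sub>m 1) (0\<^sub>m 1 m) (0\<^sub>m m 1) (1\<^sub>m m)"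
    unfolding adj using mult[of "1\<^sub>m 1" "1\<^sub>m 1" "mat_adjoint U" U] Uc
    by (simp add: unitary_mat_right_inverse(2)[OF Uc])
  also have "\<dots> = 1\<^sub>m (Suc m)" by (rule eq_matI) auto
  finally have "unitary_mat ?F"
    using F Uc by (simp add: unitary_mat_def square_mat.simps)
  moreover have "?A = ?F * mat_diag (Suc m) (\<lambda>i. complex_of_real (?d i)) * mat_adjoint ?F"
    unfolding adj D using Uc mult_carrier_mat[OF Uc(1), of ?D m]
    by (simp only: mult[of "1\<^sub>m 1" ?E U ?D] mult[of "1\<^sub>m 1 * ?E" "1\<^sub>m 1" "U * ?D" "mat_adjoint U"]
        one_carrier_mat mat_carrier mat_diag_dim mat_adjoint_carrier mult_carrier_mat[of _ 1 1 _ 1])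
      (simp add: BU)
  ultimately show ?thesis using carrier_matD[OF B] carrier_matD[OF Uc(1)] F by (simp add: unitary_diag_def del: index_mat_four_block(1))
qed

text \<open>Induction on the dimension: conjugation by a unitary matrix whose first column is an
  eigenvector splits off the eigenvalue, and the remaining block is Hermitian of smaller
  size.\<close>

theorem hermitian_unitary_diag:
  assumes "A \<in> carrier_mat n n" "hermitian_mat A"
  shows "\<exists>U d. unitary_diag A U d"
  using assms
proof (induction n arbitrary: A)
  case 0
  then have "unitary_diag A (1\<^sub>m 0) (\<lambda>_. 0)"
    by (auto simp: unitary_diag_def unitary_mat_def square_mat.simps intro!: eq_matI)
  then show ?case by blast
next
  case (Suc m)
  note A = Suc.prems(1)
  have "\<not> constant (poly (char_poly A))"
    using degree_monic_char_poly[OF A] by (simp add: constant_degree)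
  then obtain e where "poly (char_poly A) e = 0" using fundamental_theorem_of_algebra by blast
  then obtain v where v: "v \<in> carrier_vec (Suc m)" "v \<noteq> 0\<^sub>v (Suc m)" "A *\<^sub>v v = e \<cdot>\<^sub>v v"
    using eigenvalue_root_char_poly[OF A] A unfolding eigenvalue_def eigenvector_def by auto
  obtain W s where W: "W \<in> carrier_mat (Suc m) (Suc m)" "unitary_mat W" "col W 0 = s \<cdot>\<^sub>v v"
    using vec_extends_to_unitary[OF v(1,2)] by metis
  define B where "B = mat_adjoint W * A * W"
  have B: "B \<in> carrier_mat (Suc m) (Suc m)"
    unfolding B_def using A W by (intro mult_carrier_mat[of _ "Suc m" "Suc m"]) auto
  have BA: "B = mat_adjoint W * (A * W)"
    unfolding B_def using A W by (intro assoc_mult_mat) auto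
  have "mat_adjoint B = B"
    using Suc.prems W unfolding BA hermitian_mat_def
    by (simp add: mat_adjoint_mult[of _ "Suc m" "Suc m" _ "Suc m"]
        assoc_mult_mat[of _ "Suc m" "Suc m" _ "Suc m" _ "Suc m"])
  then have sym: "B $$ (i, j) = cnj (B $$ (j, i))" if "i < Suc m" "j < Suc m" for i j
    using mat_adjoint_index[of i B j] that B by auto
  have "col (A * W) 0 = A *\<^sub>v (s \<cdot>\<^sub>v v)"
    unfolding W(3)[symmetric] using A W(1) by (intro col_mult2) auto
  also have "\<dots> = e \<cdot>\<^sub>v col W 0"
    using mult_mat_vec[OF A v(1), of s] by (simp add: v(3) W(3) smult_smult_assoc mult.commute)
  finally have colAW: "col (A * W) 0 = e \<cdot>\<^sub>v col W 0" .
  then have col0: "B $$ (i, 0) = (if i = 0 then e else 0)" if "i < Suc m" for i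
  proof -
    have "B $$ (i, 0) = (e \<cdot>\<^sub>v col W 0) \<bullet>c col W i"
      unfolding BA using colAW that A W by (subst mat_adjoint_mult_index) auto
    also have "\<dots> = e * (col W 0 \<bullet>c col W i)"
      using W(1) by (intro smult_scalar_prod_distrib[of _ "Suc m"]) (auto intro!: carrier_vecI)
    also have "\<dots> = e * (mat_adjoint W * W) $$ (i, 0)"
      using that W(1) by (subst mat_adjoint_mult_index) auto
    finally show ?thesis using that unitary_mat_right_inverse[OF W(1,2)] by simp
  qed
  \<comment> \<open>Hermitian symmetry carries the zeros of the first column over to the first
    row.\<close>
  have row0: "B $$ (0, j) = 0" if "0 < j" "j < Suc m" for j
    using sym[of 0 j] col0[of j] that by simp
  \<comment> \<open>The eigenvalue is a diagonal entry of a Hermitian matrix, hence its own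
    conjugate.\<close>
  have e: "complex_of_real (Re e) = e"
    using sym[of 0 0] col0[of 0] by (simp add: complex_eq_iff)
  define C where "C = mat m m (\<lambda>(i, j). B $$ (Suc i, Suc j))"
  have C: "C \<in> carrier_mat m m" by (simp add: C_def)
  have "mat_adjoint C = C"
  proof (rule eq_matI)
    fix i k assume "i < dim_row C" "k < dim_col C"
    then show "mat_adjoint C $$ (i, k) = C $$ (i, k)"
      using sym[of "Suc i" "Suc k"] by (simp add: C_def)
  qed (use C in auto)
  with Suc.IH[OF C] obtain U d where U: "unitary_diag C U d"
    unfolding hermitian_mat_def by blast
  have "B = four_block_mat (mat 1 1 (\<lambda>_. complex_of_real (Re e))) (0\<^sub>m 1 m) (0\<^sub>m m 1) C"
  proof (rule eq_matI)
    fix i k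
    assume "i < dim_row (four_block_mat (mat 1 1 (\<lambda>_. complex_of_real (Re e))) (0\<^sub>m 1 m) (0\<^sub>m m 1) C)"
      "k < dim_col (four_block_mat (mat 1 1 (\<lambda>_. complex_of_real (Re e))) (0\<^sub>m 1 m) (0\<^sub>m m 1) C)"
    then have "i < Suc m" "k < Suc m" using C by auto
    then show "B $$ (i, k)
        = four_block_mat (mat 1 1 (\<lambda>_. complex_of_real (Re e))) (0\<^sub>m 1 m) (0\<^sub>m m 1) C $$ (i, k)"
      using col0[of i] row0[of k] e by (cases "i = 0"; cases "k = 0") (simp_all add: C_def)
  qed (use B C in auto)
  with unitary_diag_four_block[OF C U, of "Re e"]
  have "unitary_diag B (four_block_mat (1\<^sub>m 1) (0\<^sub>m 1 m) (0\<^sub>m m 1) U)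
      (\<lambda>i. case i of 0 \<Rightarrow> Re e | Suc k \<Rightarrow> d k)" by simp
  from unitary_diag_conjugate[OF A W(1,2) this[unfolded B_def]] show ?case by blast
qed

section \<open>Eigenvalue inequalities\<close>

text \<open>Similar matrices share their characteristic polynomial, and that of the diagonal factor
  is a product of linear factors with roots \<open>d i\<close>.\<close>

lemma herm_eigvals_unitary_diag:
  assumes A: "A \<in> carrier_mat n n" and U: "unitary_diag A U d"
  shows "herm_eigvals A = rev (sort (map d [0..<n]))"
proof -
  let ?D = "mat_diag n (\<lambda>i. complex_of_real (d i))"
  have Uc: "U \<in> carrier_mat n n" "unitary_mat U" and AU: "A = U * ?D * mat_adjoint U"
    using A U by (auto simp: unitary_diag_def)
  have "similar_mat A ?D"
    unfolding similar_mat_def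
    using A Uc AU unitary_mat_right_inverse[OF Uc]
    by (intro exI[of _ U] exI[of _ "mat_adjoint U"] similar_mat_witI[of _ _ n]) auto
  then have "char_poly A = char_poly ?D" by (rule char_poly_similar)
  also have "\<dots> = (\<Prod>a\<leftarrow>diag_mat ?D. [:- a, 1:])"
    by (rule char_poly_upper_triangular[of _ n]) (auto simp: mat_diag_def)
  also have "diag_mat ?D = map (\<lambda>i. complex_of_real (d i)) [0..<n]"
    by (auto simp: diag_mat_def mat_diag_def)
  finally have "char_poly A = (\<Prod>p\<leftarrow>map (\<lambda>i. [:- complex_of_real (d i), 1:]) [0..<n]. p)"
    by (simp add: o_def)
  then have "proots (char_poly A) = (\<Sum>p\<leftarrow>map (\<lambda>i. [:- complex_of_real (d i), 1:]) [0..<n]. proots p)"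
    by (simp only:) (rule proots_prod_list, auto)
  also have "\<dots> = (\<Sum>i\<leftarrow>[0..<n]. {#complex_of_real (d i)#})" by (simp add: o_def)
  also have "image_mset Re \<dots> = mset (map d [0..<n])"
    by (induction n) auto
  finally have "image_mset Re (proots (char_poly A)) = mset (map d [0..<n])" .
  then show ?thesis by (simp add: herm_eigvals_def del: mset_map)
qed

text \<open>Padding the equations with zero rows gives a square matrix of determinant 0, which has a
  nontrivial kernel.\<close>

lemma nonzero_solution_of_few_equations:
  fixes rs :: "'a :: field Matrix.vec list"
  assumes rs: "set rs \<subseteq> carrier_vec n" and len: "length rs < n"
  obtains v where "v \<in> carrier_vec n" "v \<noteq> 0\<^sub>v n" "\<forall>r\<in>set rs. r \<bullet> v = 0"
proof -
  define M where "M = mat\<^sub>r n n (\<lambda>i. if i < length rs then rs ! i else 0\<^sub>v n)"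
  \<comment> \<open>The row with index \<open>length rs\<close> is singled out as a zero row; it
    lies inside the matrix because there are fewer than \<open>n\<close> equations.\<close>
  have "det (mat\<^sub>r n n (\<lambda>i. if i = length rs then 0\<^sub>v n else if i < length rs then rs ! i else 0\<^sub>v n)) = 0"
    by (rule det_row_0[OF len]) (use rs in \<open>auto simp: subset_iff\<close>)
  also have "(\<lambda>i. if i = length rs then 0\<^sub>v n else if i < length rs then rs ! i else 0\<^sub>v n)
      = (\<lambda>i. if i < length rs then rs ! i else 0\<^sub>v n)" by auto
  finally have "det M = 0" by (simp add: M_def)
  moreover have M: "M \<in> carrier_mat n n" by (simp add: M_def)
  ultimately obtain v where v: "v \<in> carrier_vec n" "v \<noteq> 0\<^sub>v n" "M *\<^sub>v v = 0\<^sub>v n"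
    using det_0_iff_vec_prod_zero_field[OF M] by blast
  have "rs ! i \<bullet> v = 0" if i: "i < length rs" for i
  proof -
    have "row M i = rs ! i" using i len rs by (auto simp: M_def subset_iff)
    then show ?thesis using arg_cong[OF v(3), of "\<lambda>w. w $ i"] i len M by simp
  qed
  then have "\<forall>r\<in>set rs. r \<bullet> v = 0" by (auto simp: in_set_conv_nth)
  then show thesis using that[OF v(1,2)] by blast
qed

text \<open>In decreasing order, the entries strictly below the one at 0-based index
  \<open>j\<close> come after it and those strictly above come before it. The two counts add up to
  less than \<open>length xs\<close>, which leaves room for a nonzero vector in Weyl's
  principle.\<close>

lemma length_filter_rev_sort_less:
  fixes xs :: "'a :: linorder list"
  assumes j: "j < length xs"
  shows "length (filter (\<lambda>z. z < rev (sort xs) ! j) xs) < length xs - j"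
    and "length (filter (\<lambda>z. rev (sort xs) ! j < z) xs) \<le> j"
proof -
  define ys where "ys = rev (sort xs)"
  have ys: "length ys = length xs" "mset ys = mset xs" by (simp_all add: ys_def)
  have desc: "ys ! k \<le> ys ! i" if "i \<le> k" "k < length xs" for i k
    using that sorted_nth_mono[OF sorted_sort, of "length xs - 1 - k" "length xs - 1 - i" xs]
    by (simp add: ys_def rev_nth)
  have len: "length (filter P xs) = card {i. i < length xs \<and> P (ys ! i)}" for P
  proof -
    have "length (filter P xs) = length (filter P ys)"
      by (metis mset_filter size_mset ys(2))
    then show ?thesis by (simp add: length_filter_conv_card ys(1))
  qed
  have "{i. i < length xs \<and> ys ! i < ys ! j} \<subseteq> {j<..<length xs}"
    using desc j by (auto simp: not_le[symmetric])
  from card_mono[OF _ this] show "length (filter (\<lambda>z. z < rev (sort xs) ! j) xs) < length xs - j"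
    using j unfolding len ys_def[symmetric] by simp
  have "{i. i < length xs \<and> ys ! j < ys ! i} \<subseteq> {..<j}"
    using desc by (auto simp: not_le[symmetric])
  from card_mono[OF _ this] show "length (filter (\<lambda>z. rev (sort xs) ! j < z) xs) \<le> j"
    unfolding len ys_def[symmetric] by simp
qed

lemma coord_eq_row:
  assumes "U \<in> carrier_mat n n" "i < n"
  shows "coord U v i = row (mat_adjoint U) i \<bullet> v"
  using assms by (simp add: coord_def)

text \<open>Weyl's monotonicity principle. If the inequality failed, a vector orthogonal to the
  eigenvectors of \<open>d\<close> below its \<open>j\<close>-th largest entry and to those of \<open>e\<close> above its \<open>j\<close>-th largest
  entry would violate the comparison of the forms; such a vector exists since these are fewer
  than \<open>n\<close> conditions.\<close>

lemma diag_form_mono_imp_sorted_le: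
  assumes U: "U \<in> carrier_mat n n" "unitary_mat U" and V: "V \<in> carrier_mat n n" "unitary_mat V"
    and le: "\<And>v. v \<in> carrier_vec n \<Longrightarrow> diag_form U d v \<le> diag_form V e v"
    and j: "j < n"
  shows "rev (sort (map d [0..<n])) ! j \<le> rev (sort (map e [0..<n])) ! j"
proof (rule ccontr)
  define x where "x = rev (sort (map d [0..<n])) ! j"
  define y where "y = rev (sort (map e [0..<n])) ! j"
  assume "\<not> ?thesis"
  then have yx: "y < x" by (simp add: x_def y_def)
  define I where "I = filter (\<lambda>i. d i < x) [0..<n]"
  define K where "K = filter (\<lambda>i. y < e i) [0..<n]"
  define rs where "rs = map (row (mat_adjoint U)) I @ map (row (mat_adjoint V)) K"
  have "length I < n - j"
    using length_filter_rev_sort_less(1)[of j "map d [0..<n]", folded x_def] j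
    by (simp add: I_def filter_map o_def)
  moreover have "length K \<le> j"
    using length_filter_rev_sort_less(2)[of j "map e [0..<n]", folded y_def] j
    by (simp add: K_def filter_map o_def)
  ultimately have "length rs < n" using j by (simp add: rs_def)
  moreover have "set rs \<subseteq> carrier_vec n" 
    using row_carrier[of "mat_adjoint U"] row_carrier[of "mat_adjoint V"]
      carrier_matD[OF U(1)] carrier_matD[OF V(1)]
    by (auto simp: rs_def)
  ultimately obtain v where v: "v \<in> carrier_vec n" "v \<noteq> 0\<^sub>v n" and 0: "\<forall>r\<in>set rs. r \<bullet> v = 0"
    using nonzero_solution_of_few_equations by blast
  have U0: "coord U v i = 0" if "i < n" "d i < x" for i
    using 0 that coord_eq_row[OF U(1), of i v] by (auto simp: rs_def I_def)
  have V0: "coord V v i = 0" if "i < n" "y < e i" for i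
    using 0 that coord_eq_row[OF V(1), of i v] by (auto simp: rs_def K_def)
  have one: "Re (v \<bullet>c v) = (\<Sum>i<n. (cmod (coord W v i))\<^sup>2)" if "W \<in> carrier_mat n n" "unitary_mat W" for W
    using parseval[OF that v(1) v(1)] by (simp flip: complex_norm_square of_real_power)
  have "v \<bullet>c v > 0" using conjugate_square_greater_0_vec[OF v(1)] v(2) by simp
  then have "0 < Re (v \<bullet>c v)" by (simp add: less_complex_def)
  \<comment> \<open>The coordinates with \<open>d i < x\<close> vanish by the choice of
    \<open>v\<close>, so every remaining weight is at least \<open>x\<close>.\<close>
  have "x * Re (v \<bullet>c v) \<le> diag_form U d v"
  proof -
    have "x * (cmod (coord U v i))\<^sup>2 \<le> d i * (cmod (coord U v i))\<^sup>2" if "i < n" for i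
      using U0[OF that] by (cases "d i < x") (auto intro: mult_right_mono)
    then show ?thesis
      unfolding one[OF U] diag_form_def sum_distrib_left using U by (auto intro: sum_mono)
  qed
  moreover have "diag_form V e v \<le> y * Re (v \<bullet>c v)"
  proof -
    have "e i * (cmod (coord V v i))\<^sup>2 \<le> y * (cmod (coord V v i))\<^sup>2" if "i < n" for i
      using V0[OF that] by (cases "y < e i") (auto intro: mult_right_mono)
    then show ?thesis
      unfolding one[OF V] diag_form_def sum_distrib_left using V by (auto intro: sum_mono)
  qed
  ultimately have "x * Re (v \<bullet>c v) \<le> y * Re (v \<bullet>c v)"
    using le[OF v(1)] by linarith
  then show False using yx \<open>0 < Re (v \<bullet>c v)\<close> by simp
qed

section \<open>Eigenvalues under monotone and antitone functional calculus\<close>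

lemma sort_map_mono_on:
  assumes "mono_on S g" "set xs \<subseteq> S"
  shows "sort (map g xs) = map g (sort xs)"
proof (rule properties_for_sort)
  have "g (sort xs ! i) \<le> g (sort xs ! j)" if "i \<le> j" "j < length xs" for i j
    using that assms nth_mem[of i "sort xs"] nth_mem[of j "sort xs"]
    by (intro mono_onD[OF assms(1)] sorted_nth_mono) auto
  then show "sorted (map g (sort xs))"
    by (auto simp: sorted_iff_nth_mono)
qed simp

lemma sort_map_antimono_on:
  assumes "antimono_on S g" "set xs \<subseteq> S"
  shows "sort (map g xs) = rev (map g (sort xs))"
proof (rule properties_for_sort)
  have "g (sort xs ! j) \<le> g (sort xs ! i)" if "i \<le> j" "j < length xs" for i j
    using that assms(2) nth_mem[of i "sort xs"] nth_mem[of j "sort xs"] sorted_nth_mono[OF sorted_sort]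
    by (intro monotone_onD[OF assms(1)]) auto
  then show "sorted (rev (map g (sort xs)))"
    by (auto simp: sorted_rev_iff_nth_mono)
qed simp

text \<open>Weyl's principle is applied to \<open>d\<close> and \<open>e\<close>, and only then is
  \<open>g\<close> applied to the ordered numbers. Scalar monotonicity of \<open>g\<close> therefore
  suffices; a Loewner comparison of \<open>X\<close> and \<open>Y\<close> themselves is not
  claimed.\<close>

lemma herm_eigval_mono:
  assumes X: "X \<in> carrier_mat n n" "unitary_diag X U (\<lambda>i. g (d i))"
    and Y: "Y \<in> carrier_mat n n" "unitary_diag Y V (\<lambda>i. g (e i))"
    and le: "\<And>v. v \<in> carrier_vec n \<Longrightarrow> diag_form U d v \<le> diag_form V e v"
    and g: "mono_on S g" "\<And>i. i < n \<Longrightarrow> d i \<in> S" "\<And>i. i < n \<Longrightarrow> e i \<in> S"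
    and j: "1 \<le> j" "j \<le> n"
  shows "herm_eigval X j \<le> herm_eigval Y j"
proof -
  have U: "U \<in> carrier_mat n n" "unitary_mat U" "V \<in> carrier_mat n n" "unitary_mat V"
    using X Y by (auto simp: unitary_diag_def)
  have eig: "herm_eigval M j = g (rev (sort (map f [0..<n])) ! (j - 1))"
    if "M \<in> carrier_mat n n" "unitary_diag M W (\<lambda>i. g (f i))" "\<And>i. i < n \<Longrightarrow> f i \<in> S" for M W f
  proof -
    have "sort (map (\<lambda>i. g (f i)) [0..<n]) = map g (sort (map f [0..<n]))"
      using sort_map_mono_on[OF g(1), of "map f [0..<n]"] that(3) by (simp add: o_def image_subset_iff)
    then show ?thesis
      using j by (simp add: herm_eigval_def herm_eigvals_unitary_diag[OF that(1,2)] rev_map)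
  qed
  have mem: "rev (sort (map f [0..<n])) ! (j - 1) \<in> S" if "\<And>i. i < n \<Longrightarrow> f i \<in> S" for f
    using nth_mem[of "j - 1" "rev (sort (map f [0..<n]))"] that j by force
  have "rev (sort (map d [0..<n])) ! (j - 1) \<le> rev (sort (map e [0..<n])) ! (j - 1)"
    by (rule diag_form_mono_imp_sorted_le[OF U le]) (use j in auto)
  moreover have "herm_eigval X j = g (rev (sort (map d [0..<n])) ! (j - 1))"
    by (rule eig[OF X]) (rule g(2))
  moreover have "herm_eigval Y j = g (rev (sort (map e [0..<n])) ! (j - 1))"
    by (rule eig[OF Y]) (rule g(3))
  ultimately show ?thesis
    by (simp only:) (intro mono_onD[OF g(1)] mem g)
qed

text \<open>The \<open>j\<close>-th largest value of a decreasing \<open>g\<close> comes from the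
  \<open>j\<close>-th smallest argument, which has 0-based index \<open>n - j\<close> in the
  decreasing list.\<close>

lemma herm_eigval_antimono:
  assumes X: "X \<in> carrier_mat n n" "unitary_diag X U (\<lambda>i. g (d i))"
    and Y: "Y \<in> carrier_mat n n" "unitary_diag Y V (\<lambda>i. g (e i))"
    and le: "\<And>v. v \<in> carrier_vec n \<Longrightarrow> diag_form U d v \<le> diag_form V e v"
    and g: "antimono_on S g" "\<And>i. i < n \<Longrightarrow> d i \<in> S" "\<And>i. i < n \<Longrightarrow> e i \<in> S"
    and j: "1 \<le> j" "j \<le> n"
  shows "herm_eigval Y j \<le> herm_eigval X j"
proof -
  have U: "U \<in> carrier_mat n n" "unitary_mat U" "V \<in> carrier_mat n n" "unitary_mat V"
    using X Y by (auto simp: unitary_diag_def)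
  have eig: "herm_eigval M j = g (rev (sort (map f [0..<n])) ! (n - j))"
    if "M \<in> carrier_mat n n" "unitary_diag M W (\<lambda>i. g (f i))" "\<And>i. i < n \<Longrightarrow> f i \<in> S" for M W f
  proof -
    have "sort (map (\<lambda>i. g (f i)) [0..<n]) = rev (map g (sort (map f [0..<n])))"
      using sort_map_antimono_on[OF g(1), of "map f [0..<n]"] that(3) by (simp add: o_def image_subset_iff)
    then show ?thesis
      using j by (simp add: herm_eigval_def herm_eigvals_unitary_diag[OF that(1,2)] rev_nth)
  qed
  have mem: "rev (sort (map f [0..<n])) ! (n - j) \<in> S" if "\<And>i. i < n \<Longrightarrow> f i \<in> S" for f
    using nth_mem[of "n - j" "rev (sort (map f [0..<n]))"] that j by force
  have "rev (sort (map d [0..<n])) ! (n - j) \<le> rev (sort (map e [0..<n])) ! (n - j)"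
    by (rule diag_form_mono_imp_sorted_le[OF U le]) (use j in auto)
  moreover have "herm_eigval X j = g (rev (sort (map d [0..<n])) ! (n - j))"
    by (rule eig[OF X]) (rule g(2))
  moreover have "herm_eigval Y j = g (rev (sort (map e [0..<n])) ! (n - j))"
    by (rule eig[OF Y]) (rule g(3))
  ultimately show ?thesis
    by (simp only:) (intro monotone_onD[OF g(1)] mem g)
qed

section \<open>Operator concavity\<close>

text \<open>The integral representation of \<open>x powr r\<close> for \<open>r = 1 / m\<close> by
  the resolvents \<open>x / (x + s)\<close>. The substitution \<open>s = u powr m\<close> turns the
  usual weight \<open>s powr (r - 1)\<close> into a constant, and scaling \<open>u\<close> by
  \<open>x powr (1 / m)\<close> removes \<open>x\<close> from the integrand.\<close>

lemma has_bochner_integral_resolvent_kernel: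
  fixes m :: real
  assumes m: "1 < m"
  obtains K where "0 < K"
    "\<And>x. 0 < x \<Longrightarrow> has_bochner_integral lborel
      (\<lambda>u. indicator {0..} u * (x / (x + u powr m))) (K * x powr (1 / m))"
proof -
  define g where "g = (\<lambda>u::real. indicator {0..} u * (1 / (1 + u powr m)))"
  \<comment> \<open>Integrable tail of a majorant for \<open>g\<close>: on the unit interval
    \<open>g\<close> is at most 1, and from 1 on it is at most \<open>u powr (-m)\<close>.\<close>
  define h where "h = (\<lambda>u::real. indicator {1..} u * u powr (-m))"
  have hm [measurable]: "h \<in> borel_measurable borel" unfolding h_def by measurable
  have gm [measurable]: "g \<in> borel_measurable borel" unfolding g_def by measurable
  have "((\<lambda>u::real. u powr (-m)) has_integral -(1 powr (-m + 1)) / (-m + 1)) {1..}"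
    by (rule has_integral_powr_to_inf) (use m in auto)
  then have "((\<lambda>u. if u \<in> {1..} then u powr (-m) else 0) has_integral -(1 powr (-m + 1)) / (-m + 1)) UNIV"
    by (subst has_integral_restrict_UNIV)
  also have "(\<lambda>u. if u \<in> {1..} then u powr (-m) else 0) = h"
    by (auto simp: h_def)
  finally have "integrable lborel h"
    using nn_integral_has_integral_lborel[OF hm]
    by (intro integrableI_nonneg) (auto simp: h_def)
  then have "integrable lborel (\<lambda>u. indicat_real {0..1} u + h u)"
    by (intro Bochner_Integration.integrable_add) auto
  then have gi: "integrable lborel g"
  proof (rule Bochner_Integration.integrable_bound)
    show "AE u in lborel. norm (g u) \<le> norm (indicat_real {0..1} u + h u)"
    proof (rule AE_I2)
      fix u :: real
      have "1 / (1 + u powr m) \<le> u powr (-m)" if "1 \<le> u"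
        using that by (simp add: powr_minus field_simps add_pos_pos)
      moreover have "1 / (1 + u powr m) \<le> 1"
        by (simp add: divide_le_eq add_pos_nonneg)
      ultimately show "norm (g u) \<le> norm (indicat_real {0..1} u + h u)"
        by (auto simp: g_def h_def indicator_def)
    qed
  qed simp
  show thesis
  proof
    \<comment> \<open>The denominator is at most 2 on the unit interval, so the constant is at least
      1/2.\<close>
    have "(\<integral>u. indicat_real {0..1::real} u * (1/2) \<partial>lborel) \<le> integral\<^sup>L lborel g"
    proof (rule Bochner_Integration.integral_mono[OF _ gi])
      fix u :: real
      have "1/2 \<le> 1 / (1 + u powr m)" if "0 \<le> u" "u \<le> 1"
      proof -
        have "u powr m \<le> 1" using powr_mono2[of m u 1] that m by simp
        then show ?thesis by (simp add: field_simps add_pos_nonneg)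
      qed
      then show "indicat_real {0..1} u * (1/2) \<le> g u" by (auto simp: g_def indicator_def)
    qed simp
    then show "0 < integral\<^sup>L lborel g" by simp
  next
    fix x :: real assume x: "0 < x"
    define c where "c = x powr (1/m)"
    have c: "0 < c" "c powr m = x" using x m by (auto simp: c_def powr_powr)
    have eq: "indicator {0..} (0 + c * u) * (x / (x + (0 + c * u) powr m)) = g u" for u
    proof (cases "0 \<le> u")
      case True
      then have "x + (c * u) powr m = x * (1 + u powr m)"
        using c by (simp add: powr_mult distrib_left)
      then show ?thesis using True c x by (simp add: g_def)
    next
      case False
      then show ?thesis using c(1) by (simp add: g_def zero_le_mult_iff)
    qed
    show "has_bochner_integral lborel (\<lambda>u. indicator {0..} u * (x / (x + u powr m)))
        (integral\<^sup>L lborel g * x powr (1 / m))"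
      using gi c
      by (subst lborel_has_bochner_integral_real_affine_iff[of c _ _ 0], simp, subst eq)
        (simp add: has_bochner_integral_iff flip: c_def)
  qed
qed

text \<open>The limit is the derivative of \<open>x powr r\<close> with respect to the exponent at
  0.\<close>

lemma tendsto_powr_minus_one_over_exponent:
  fixes x :: real
  assumes "0 < x"
  shows "((\<lambda>r. (x powr r - 1) / r) \<longlongrightarrow> ln x) (at_right 0)"
proof -
  have "((\<lambda>r. x powr r) has_real_derivative x powr 0 * ln x) (at 0)"
    using assms by (auto intro!: derivative_eq_intros)
  then have "((\<lambda>r. (x powr (0 + r) - x powr 0) / r) \<longlongrightarrow> x powr 0 * ln x) (at 0)"
    by (simp add: DERIV_def)
  then show ?thesis using assms by (auto intro: filterlim_at_split[THEN iffD1, THEN conjunct2])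
qed

text \<open>One half of the variational formula for the inverse. In each coordinate it follows from
  \<open>0 \<le> (cmod x - r * cmod y)\<^sup>2\<close> and
  \<open>Re (x * cnj y) \<le> cmod x * cmod y\<close> after division by \<open>r\<close>.\<close>

lemma diag_form_inverse_ge:
  assumes U: "U \<in> carrier_mat n n" "unitary_mat U" and a: "\<forall>i<n. 0 < a i"
    and v: "v \<in> carrier_vec n" and w: "w \<in> carrier_vec n"
  shows "2 * Re (v \<bullet>c w) - diag_form U a w \<le> diag_form U (\<lambda>i. 1 / a i) v"
proof -
  have *: "2 * Re (x * cnj y) - r * (cmod y)\<^sup>2 \<le> 1 / r * (cmod x)\<^sup>2" if "0 < r" for x y r
  proof -
    have "Re (x * cnj y) \<le> cmod x * cmod y"
      using complex_Re_le_cmod[of "x * cnj y"] by (simp add: norm_mult)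
    then have "2 * Re (x * cnj y) * r \<le> 2 * (cmod x * cmod y) * r"
      using that by simp
    moreover have "0 \<le> (cmod x - r * cmod y)\<^sup>2" by simp
    ultimately have "2 * Re (x * cnj y) * r \<le> (cmod x)\<^sup>2 + r * r * (cmod y)\<^sup>2"
      by (simp add: power2_eq_square algebra_simps)
    then show ?thesis using that by (simp add: field_simps power2_eq_square)
  qed
  have "2 * Re (v \<bullet>c w) - diag_form U a w
      = (\<Sum>i<n. 2 * Re (coord U v i * cnj (coord U w i)) - a i * (cmod (coord U w i))\<^sup>2)"
    using U by (simp add: parseval[OF U v w] diag_form_def sum_subtractf sum_distrib_left)
  also have "\<dots> \<le> (\<Sum>i<n. 1 / a i * (cmod (coord U v i))\<^sup>2)"
    using a by (intro sum_mono *) simp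
  finally show ?thesis using U by (simp add: diag_form_def)
qed

section \<open>Concavity inequalities for one fixed convex combination\<close>

text \<open>\<open>Z diag(c) Z\<^sup>*\<close> is the convex combination of \<open>U diag(a) U\<^sup>*\<close> and \<open>V diag(b) V\<^sup>*\<close>,
  expressed through the quadratic forms.\<close>

locale diag_combination =
  fixes n :: nat and t :: real and U V Z :: "complex mat" and a b c :: "nat \<Rightarrow> real"
  assumes U: "U \<in> carrier_mat n n" "unitary_mat U"
    and V: "V \<in> carrier_mat n n" "unitary_mat V"
    and Z: "Z \<in> carrier_mat n n" "unitary_mat Z"
    and a: "\<forall>i<n. 0 < a i" and b: "\<forall>i<n. 0 < b i" and c: "\<forall>i<n. 0 < c i"
    and t: "0 \<le> t" "t \<le> 1"
    and combination: "v \<in> carrier_vec n \<Longrightarrow>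
      diag_form Z c v = (1 - t) * diag_form U a v + t * diag_form V b v"
begin

text \<open>The operator concavity inequality for \<open>f\<close> in the Loewner order, at this one
  combination and not for all pairs of matrices.\<close>

definition concave_form :: "(real \<Rightarrow> real) \<Rightarrow> bool" where
  "concave_form f \<longleftrightarrow> (\<forall>v\<in>carrier_vec n.
     (1 - t) * diag_form U (\<lambda>i. f (a i)) v + t * diag_form V (\<lambda>i. f (b i)) v
     \<le> diag_form Z (\<lambda>i. f (c i)) v)"

text \<open>For fixed \<open>w\<close> the variational expression is affine in the matrix, so it
  splits along the combination, and each part is bounded by its own inverse form.\<close>

lemma diag_form_inverse_convex:
  assumes v: "v \<in> carrier_vec n"
  shows "diag_form Z (\<lambda>i. 1 / c i) v
    \<le> (1 - t) * diag_form U (\<lambda>i. 1 / a i) v + t * diag_form V (\<lambda>i. 1 / b i) v"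
proof -
  \<comment> \<open>The inverse of \<open>Z diag(c) Z\<^sup>*\<close> applied to \<open>v\<close>;
    at this \<open>w\<close> the variational bound for the combination is an equality.\<close>
  define w where "w = Z *\<^sub>v Matrix.vec n (\<lambda>i. coord Z v i / of_real (c i))"
  have w: "w \<in> carrier_vec n" using Z by (simp add: w_def)
  have cw: "coord Z w i = coord Z v i / of_real (c i)" if "i < n" for i
    unfolding w_def by (rule coord_unitary[OF Z that])
  have "Re (v \<bullet>c w) = diag_form Z (\<lambda>i. 1 / c i) v"
    using Z by (simp add: parseval[OF Z v w] diag_form_def cw flip: complex_norm_square of_real_power)
  moreover have "diag_form Z c w = diag_form Z (\<lambda>i. 1 / c i) v"
    unfolding diag_form_def using Z c
    by (auto intro!: sum.cong simp: cw norm_divide power_divide power2_eq_square)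
  ultimately have "diag_form Z (\<lambda>i. 1 / c i) v = 2 * Re (v \<bullet>c w) - diag_form Z c w" by simp
  also have "\<dots> = (1 - t) * (2 * Re (v \<bullet>c w) - diag_form U a w)
      + t * (2 * Re (v \<bullet>c w) - diag_form V b w)"
    by (simp add: combination[OF w] algebra_simps)
  also have "\<dots> \<le> (1 - t) * diag_form U (\<lambda>i. 1 / a i) v + t * diag_form V (\<lambda>i. 1 / b i) v"
    using t diag_form_inverse_ge[OF U a v w] diag_form_inverse_ge[OF V b v w]
    by (intro add_mono mult_left_mono) auto
  finally show ?thesis .
qed

lemma diag_form_const:
  assumes "W \<in> carrier_mat n n" "unitary_mat W" "v \<in> carrier_vec n"
  shows "diag_form W (\<lambda>_. s) v = s * Re (v \<bullet>c v)"
  using assms by (simp add: parseval[OF assms(1,2,3,3)] diag_form_def sum_distrib_left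
      flip: complex_norm_square of_real_power)

lemma diag_form_affine:
  assumes "W \<in> carrier_mat n n" "unitary_mat W" "v \<in> carrier_vec n"
  shows "diag_form W (\<lambda>i. r + s * d i) v = r * Re (v \<bullet>c v) + s * diag_form W d v"
  unfolding diag_form_const[OF assms, symmetric]
  by (simp add: diag_form_def sum.distrib sum_distrib_left algebra_simps)

text \<open>Adding \<open>s\<close> times the identity to all three matrices keeps the combination
  since the weights sum to 1; resolvents are inverses of such shifts.\<close>

lemma shifted:
  assumes s: "0 \<le> s"
  shows "diag_combination n t U V Z (\<lambda>i. s + a i) (\<lambda>i. s + b i) (\<lambda>i. s + c i)"
proof
  fix v :: "complex Matrix.vec" assume v: "v \<in> carrier_vec n"
  show "diag_form Z (\<lambda>i. s + c i) v
      = (1 - t) * diag_form U (\<lambda>i. s + a i) v + t * diag_form V (\<lambda>i. s + b i) v"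
    using diag_form_affine[OF Z v, of s 1 c] diag_form_affine[OF U v, of s 1 a]
      diag_form_affine[OF V v, of s 1 b] combination[OF v]
    by (simp add: algebra_simps)
qed (use U V Z a b c t s in \<open>auto intro: add_nonneg_pos\<close>)

text \<open>From \<open>x / (x + s) = 1 - s / (x + s)\<close> and convexity of the inverse for the
  shifted matrices, the factor \<open>-s\<close> reversing the inequality.\<close>

lemma concave_form_resolvent:
  assumes s: "0 \<le> s"
  shows "concave_form (\<lambda>x. x / (x + s))"
  unfolding concave_form_def
proof
  fix v :: "complex Matrix.vec" assume v: "v \<in> carrier_vec n"
  interpret shift: diag_combination n t U V Z "\<lambda>i. s + a i" "\<lambda>i. s + b i" "\<lambda>i. s + c i"
    by (rule shifted[OF s])
  have *: "diag_form W (\<lambda>i. d i / (d i + s)) v = Re (v \<bullet>c v) - s * diag_form W (\<lambda>i. 1 / (s + d i)) v"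
    if W: "W \<in> carrier_mat n n" "unitary_mat W" and d: "\<forall>i<n. 0 < d i" for W d
  proof -
    have "diag_form W (\<lambda>i. d i / (d i + s)) v = diag_form W (\<lambda>i. 1 + (-s) * (1 / (s + d i))) v"
    proof -
      have "d i / (d i + s) = 1 + (-s) * (1 / (s + d i))" if "i < n" for i
        using add_nonneg_pos[OF s, of "d i"] d that by (simp add: divide_simps)
      then show ?thesis unfolding diag_form_def using W by (auto intro!: sum.cong)
    qed
    also have "\<dots> = Re (v \<bullet>c v) - s * diag_form W (\<lambda>i. 1 / (s + d i)) v"
      by (subst diag_form_affine[OF W v]) simp
    finally show ?thesis .
  qed
  show "(1 - t) * diag_form U (\<lambda>i. a i / (a i + s)) v + t * diag_form V (\<lambda>i. b i / (b i + s)) v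
      \<le> diag_form Z (\<lambda>i. c i / (c i + s)) v"
    using mult_left_mono[OF shift.diag_form_inverse_convex[OF v] s]
    unfolding *[OF U a] *[OF V b] *[OF Z c] by (simp add: algebra_simps)
qed

lemma concave_form_powr:
  assumes r: "0 < r" "r < 1"
  shows "concave_form (\<lambda>x. x powr r)"
  unfolding concave_form_def
proof
  fix v :: "complex Matrix.vec" assume v: "v \<in> carrier_vec n"
  define m where "m = 1 / r"
  have m: "1 < m" "1 / m = r" using r by (auto simp: m_def)
  obtain K where K: "0 < K"
    "\<And>x. 0 < x \<Longrightarrow> has_bochner_integral lborel
      (\<lambda>u. indicator {0..} u * (x / (x + u powr m))) (K * x powr r)"
    using has_bochner_integral_resolvent_kernel[OF m(1)] m(2) by metis
  define k where "k = (\<lambda>u x. indicator {0..} u * (x / (x + u powr m)) :: real)"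
  \<comment> \<open>A form is a finite sum over eigenvalues, so the scalar integral formula applies
    term by term.\<close>
  have int: "has_bochner_integral lborel (\<lambda>u. diag_form W (\<lambda>i. k u (d i)) v)
      (K * diag_form W (\<lambda>i. d i powr r) v)"
    if W: "W \<in> carrier_mat n n" and d: "\<forall>i<n. 0 < d i" for W d
  proof -
    have "has_bochner_integral lborel (\<lambda>u. \<Sum>i<n. k u (d i) * (cmod (coord W v i))\<^sup>2)
        (\<Sum>i<n. K * d i powr r * (cmod (coord W v i))\<^sup>2)"
      unfolding k_def by (intro has_bochner_integral_sum has_bochner_integral_mult_left K(2))
        (use d in simp)
    then show ?thesis using W by (simp add: diag_form_def sum_distrib_left mult.assoc)
  qed
  let ?l = "\<lambda>u. (1 - t) * diag_form U (\<lambda>i. k u (a i)) v + t * diag_form V (\<lambda>i. k u (b i)) v"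
  have l: "has_bochner_integral lborel ?l ((1 - t) * (K * diag_form U (\<lambda>i. a i powr r) v)
      + t * (K * diag_form V (\<lambda>i. b i powr r) v))"
    by (intro has_bochner_integral_add has_bochner_integral_mult_right int U V a b)
  have "?l u \<le> diag_form Z (\<lambda>i. k u (c i)) v" for u
  proof (cases "0 \<le> u")
    case True
    then show ?thesis
      using concave_form_resolvent[of "u powr m"] v by (simp add: concave_form_def k_def)
  next
    case False
    then show ?thesis by (simp add: k_def diag_form_def)
  qed
  then have "(1 - t) * (K * diag_form U (\<lambda>i. a i powr r) v)
      + t * (K * diag_form V (\<lambda>i. b i powr r) v) \<le> K * diag_form Z (\<lambda>i. c i powr r) v"
    using l int[OF Z(1) c] by (auto simp: has_bochner_integral_iff dest: Bochner_Integration.integral_mono)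
  then have "K * ((1 - t) * diag_form U (\<lambda>i. a i powr r) v + t * diag_form V (\<lambda>i. b i powr r) v)
      \<le> K * diag_form Z (\<lambda>i. c i powr r) v"
    by (simp add: algebra_simps)
  then show "(1 - t) * diag_form U (\<lambda>i. a i powr r) v + t * diag_form V (\<lambda>i. b i powr r) v
      \<le> diag_form Z (\<lambda>i. c i powr r) v"
    using K(1) by simp
qed

text \<open>The inequality for powers survives subtracting 1, which contributes
  \<open>Re (v \<bullet>c v)\<close> on both sides, and dividing by \<open>r > 0\<close>; then
  \<open>r\<close> tends to 0 from the right.\<close>

lemma concave_form_ln: "concave_form ln"
  unfolding concave_form_def
proof
  fix v :: "complex Matrix.vec" assume v: "v \<in> carrier_vec n"
  let ?q = "\<lambda>r x. (x powr r - 1) / r :: real"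
  have lim: "((\<lambda>r. diag_form W (\<lambda>i. ?q r (d i)) v) \<longlongrightarrow> diag_form W (\<lambda>i. ln (d i)) v) (at_right 0)"
    if "W \<in> carrier_mat n n" "\<forall>i<n. 0 < d i" for W d
    unfolding diag_form_def using that
    by (intro tendsto_sum tendsto_mult tendsto_const tendsto_powr_minus_one_over_exponent) auto
  show "(1 - t) * diag_form U (\<lambda>i. ln (a i)) v + t * diag_form V (\<lambda>i. ln (b i)) v
      \<le> diag_form Z (\<lambda>i. ln (c i)) v"
  proof (rule tendsto_le)
    show "((\<lambda>r. diag_form Z (\<lambda>i. ?q r (c i)) v) \<longlongrightarrow> diag_form Z (\<lambda>i. ln (c i)) v) (at_right 0)"
      by (rule lim[OF Z(1) c])
    show "((\<lambda>r. (1 - t) * diag_form U (\<lambda>i. ?q r (a i)) v + t * diag_form V (\<lambda>i. ?q r (b i)) v)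
      \<longlongrightarrow> (1 - t) * diag_form U (\<lambda>i. ln (a i)) v + t * diag_form V (\<lambda>i. ln (b i)) v) (at_right 0)"
      by (intro tendsto_add tendsto_mult tendsto_const lim U V a b)
    have "(1 - t) * diag_form U (\<lambda>i. ?q r (a i)) v + t * diag_form V (\<lambda>i. ?q r (b i)) v
        \<le> diag_form Z (\<lambda>i. ?q r (c i)) v" if r: "0 < r" "r < 1" for r
    proof -
      have q: "diag_form W (\<lambda>i. ?q r (d i)) v = (diag_form W (\<lambda>i. d i powr r) v - Re (v \<bullet>c v)) / r"
        if W: "W \<in> carrier_mat n n" "unitary_mat W" for W d
        using diag_form_affine[OF W v, of "-1/r" "1/r" "\<lambda>i. d i powr r"]
        by (simp add: diff_divide_distrib)
      have "(1 - t) * diag_form U (\<lambda>i. a i powr r) v + t * diag_form V (\<lambda>i. b i powr r) v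
        \<le> diag_form Z (\<lambda>i. c i powr r) v"
        using concave_form_powr[OF r] v by (auto simp: concave_form_def)
      then have "((1 - t) * diag_form U (\<lambda>i. a i powr r) v + t * diag_form V (\<lambda>i. b i powr r) v
          - Re (v \<bullet>c v)) / r \<le> (diag_form Z (\<lambda>i. c i powr r) v - Re (v \<bullet>c v)) / r"
        using r by (intro divide_right_mono) auto
      then show ?thesis
        unfolding q[OF U] q[OF V] q[OF Z]
        by (simp add: diff_divide_distrib add_divide_distrib left_diff_distrib right_diff_distrib)
    qed
    then show "\<forall>\<^sub>F r in at_right 0. (1 - t) * diag_form U (\<lambda>i. ?q r (a i)) v
        + t * diag_form V (\<lambda>i. ?q r (b i)) v \<le> diag_form Z (\<lambda>i. ?q r (c i)) v"
      by (intro eventually_at_rightI[of 0 1]) auto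
  qed simp
qed

end

section \<open>Monotonicity of the means\<close>

lemma smult_mat_mult_vec:
  assumes "A \<in> carrier_mat m n" "v \<in> carrier_vec n"
  shows "(k \<cdot>\<^sub>m A) *\<^sub>v v = k \<cdot>\<^sub>v (A *\<^sub>v v)"
  using assms by (intro eq_vecI) (auto simp: scalar_prod_def sum_distrib_left mult.assoc)

text \<open>The combination is Hermitian, hence diagonalizable, and linearity of the quadratic form
  in the matrix yields the relation assumed in \<open>diag_combination\<close>.\<close>

lemma convex_combination_unitary_diag:
  assumes P: "P \<in> carrier_mat n n" "unitary_diag P U a"
    and Q: "Q \<in> carrier_mat n n" "unitary_diag Q V b"
  obtains Z c where
    "unitary_diag (complex_of_real (1 - t) \<cdot>\<^sub>m P + complex_of_real t \<cdot>\<^sub>m Q) Z c"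
    "\<And>v. v \<in> carrier_vec n \<Longrightarrow>
      diag_form Z c v = (1 - t) * diag_form U a v + t * diag_form V b v"
proof -
  let ?M = "complex_of_real (1 - t) \<cdot>\<^sub>m P + complex_of_real t \<cdot>\<^sub>m Q"
  have M: "?M \<in> carrier_mat n n" using P Q by simp
  have "hermitian_mat ?M"
    using hermitian_if_unitary_diag[OF P] hermitian_if_unitary_diag[OF Q] P Q
    unfolding hermitian_mat_def
    by (subst mat_adjoint_add[of _ n n]) (auto simp: mat_adjoint_smult)
  then obtain Z c where Z: "unitary_diag ?M Z c" using hermitian_unitary_diag[OF M] by blast
  have "diag_form Z c v = (1 - t) * diag_form U a v + t * diag_form V b v"
    if v: "v \<in> carrier_vec n" for v
  proof -
    have Pv: "P *\<^sub>v v \<in> carrier_vec n" "Q *\<^sub>v v \<in> carrier_vec n" using P Q v by auto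
    have "?M *\<^sub>v v = complex_of_real (1 - t) \<cdot>\<^sub>v (P *\<^sub>v v) + complex_of_real t \<cdot>\<^sub>v (Q *\<^sub>v v)"
      using P(1) Q(1) v by (subst add_mult_distrib_mat_vec[of _ n n]) (auto simp: smult_mat_mult_vec)
    then have "(?M *\<^sub>v v) \<bullet>c v = complex_of_real (1 - t) * ((P *\<^sub>v v) \<bullet>c v)
        + complex_of_real t * ((Q *\<^sub>v v) \<bullet>c v)"
      using Pv v by (simp add: add_scalar_prod_distrib[of _ n] smult_scalar_prod_distrib[of _ n]
          del: of_real_diff)
    then show ?thesis
      unfolding diag_form_eq[OF M Z v, symmetric] diag_form_eq[OF P v, symmetric]
        diag_form_eq[OF Q v, symmetric] by simp
  qed
  with Z show thesis by (rule that)
qed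

theorem theorem1:
  fixes A B :: "complex mat" and n j :: nat and t :: real
  assumes "A \<in> carrier_mat n n" and "B \<in> carrier_mat n n"
    and "pos_def_mat A" and "pos_def_mat B"
    and "0 \<le> t" and "t \<le> 1"
    and "1 \<le> j" and "j \<le> n"
  shows "mono (\<lambda>p::real. herm_eigval (matrix_mean t A B p) j)"
proof -
  note AB = assms(1,2) and t = assms(5,6) and j = assms(7,8)
  obtain U a where U: "unitary_diag A U a"
    using hermitian_unitary_diag[OF AB(1)] assms(3) by (auto simp: pos_def_mat_def)
  obtain V b where V: "unitary_diag B V b"
    using hermitian_unitary_diag[OF AB(2)] assms(4) by (auto simp: pos_def_mat_def)
  have a: "\<forall>i<n. 0 < a i" and b: "\<forall>i<n. 0 < b i"
    using assms(3,4) pos_def_mat_iff[OF AB(1) U] pos_def_mat_iff[OF AB(2) V] by auto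
  have Uc: "U \<in> carrier_mat n n" "unitary_mat U" and Vc: "V \<in> carrier_mat n n" "unitary_mat V"
    using U V AB by (auto simp: unitary_diag_def)
  \<comment> \<open>The matrix averaged inside the mean: \<open>f\<close> is a power for nonzero
    exponents and the logarithm for exponent 0.\<close>
  define L where "L = (\<lambda>f. complex_of_real (1 - t) \<cdot>\<^sub>m herm_fun f A + complex_of_real t \<cdot>\<^sub>m herm_fun f B)"
  define F where "F = matrix_mean t A B"
  have Lc: "L f \<in> carrier_mat n n" for f
    using herm_fun_carrier[OF AB(1) U] herm_fun_carrier[OF AB(2) V] by (simp add: L_def)
  have "\<exists>Z c. unitary_diag (L f) Z c \<and> (\<forall>v\<in>carrier_vec n. diag_form Z c v
      = (1 - t) * diag_form U (\<lambda>i. f (a i)) v + t * diag_form V (\<lambda>i. f (b i)) v)" for f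
    unfolding L_def
    using convex_combination_unitary_diag[where t = t,
        OF herm_fun_carrier[OF AB(1) U] unitary_diag_herm_fun[OF AB(1) U]
          herm_fun_carrier[OF AB(2) V] unitary_diag_herm_fun[OF AB(2) V], of f f] by metis
  then obtain Z c where Z: "\<And>f. unitary_diag (L f) (Z f) (c f)"
    and Z_form: "\<And>f v. v \<in> carrier_vec n \<Longrightarrow> diag_form (Z f) (c f) v
      = (1 - t) * diag_form U (\<lambda>i. f (a i)) v + t * diag_form V (\<lambda>i. f (b i)) v"
    by metis
  have Zc: "Z f \<in> carrier_mat n n" "unitary_mat (Z f)" for f
    using Z[of f] Lc[of f] by (auto simp: unitary_diag_def)
  define pw where "pw = (\<lambda>p x :: real. x powr p)"
  define W d where "W = (\<lambda>p. Z (pw p))" and "d = (\<lambda>p. c (pw p))"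
  define W0 l where "W0 = Z ln" and "l = c ln"
  have W_form: "diag_form (W p) (d p) v
      = (1 - t) * diag_form U (\<lambda>i. a i powr p) v + t * diag_form V (\<lambda>i. b i powr p) v"
    if "v \<in> carrier_vec n" for p v
    using Z_form[OF that, of "pw p"] by (simp add: W_def d_def pw_def)
  have Wc: "W p \<in> carrier_mat n n" "unitary_mat (W p)" for p
    using Zc by (simp_all add: W_def)
  have d: "\<forall>i<n. 0 < d p i" for p
  proof (rule iffD1[OF diag_form_pos_iff[OF Wc[of p]]], intro ballI impI)
    fix v :: "complex Matrix.vec" assume v: "v \<in> carrier_vec n" "v \<noteq> 0\<^sub>v n"
    have "0 < diag_form U (\<lambda>i. a i powr p) v" "0 < diag_form V (\<lambda>i. b i powr p) v"
      using diag_form_pos_iff[OF Uc, of "\<lambda>i. a i powr p"] diag_form_pos_iff[OF Vc, of "\<lambda>i. b i powr p"]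
        v a b by auto
    \<comment> \<open>Either \<open>t = 0\<close> and the first weight is 1, or the second weight is
      positive.\<close>
    then show "0 < diag_form (W p) (d p) v"
      unfolding W_form[OF v(1)] using t
      by (cases "t = 0") (auto intro: add_nonneg_pos)
  qed
  have d_nonzero: "d p i \<noteq> 0" if "i < n" for p i using d[of p] that by auto
  have comb: "diag_combination n t U V (W p) (\<lambda>i. a i powr p) (\<lambda>i. b i powr p) (d p)" for p
    by unfold_locales (use Uc Vc Wc a b d t W_form in auto)
  have F: "unitary_diag (F p) (W p) (\<lambda>i. d p i powr (1 / p))" "F p \<in> carrier_mat n n" if "p \<noteq> 0" for p
    using unitary_diag_herm_fun[OF Lc Z, of "\<lambda>x. x powr (1 / p)" "pw p"]
      herm_fun_carrier[OF Lc Z, of "\<lambda>x. x powr (1 / p)" "pw p"] that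
    by (simp_all add: F_def matrix_mean_def L_def W_def d_def pw_def)
  have F0: "unitary_diag (F 0) W0 (\<lambda>i. exp (l i))" "F 0 \<in> carrier_mat n n"
    using unitary_diag_herm_fun[OF Lc Z, of exp ln] herm_fun_carrier[OF Lc Z, of exp ln]
    by (simp_all add: F_def matrix_mean_def L_def W0_def l_def)
  \<comment> \<open>Concavity of the power \<open>p / q\<close> at the averaged \<open>q\<close>-th
    powers, as \<open>(x powr q) powr (p / q) = x powr p\<close>. The condition on the ratio covers
    both signs, with \<open>q\<close> farther from 0 than \<open>p\<close>.\<close>
  have powr_le: "diag_form (W p) (d p) v \<le> diag_form (W q) (\<lambda>i. d q i powr (p / q)) v"
    if pq: "0 < p / q" "p / q < 1" and v: "v \<in> carrier_vec n" for p q v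
  proof -
    interpret diag_combination n t U V "W q" "\<lambda>i. a i powr q" "\<lambda>i. b i powr q" "d q" by (rule comb)
    have "q \<noteq> 0" using pq by auto
    then show ?thesis
      using concave_form_powr[OF pq] v W_form[OF v, of p] \<open>q \<noteq> 0\<close>
      by (auto simp: concave_form_def powr_powr)
  qed
  \<comment> \<open>The factor \<open>q\<close> stays with \<open>l\<close>, so the inequality holds
    for both signs of \<open>q\<close>; dividing by \<open>q\<close> is left to the scalar
    map.\<close>
  have ln_le: "diag_form W0 (\<lambda>i. q * l i) v \<le> diag_form (W q) (\<lambda>i. ln (d q i)) v"
    if v: "v \<in> carrier_vec n" for q v
  proof -
    interpret diag_combination n t U V "W q" "\<lambda>i. a i powr q" "\<lambda>i. b i powr q" "d q" by (rule comb)
    have scale: "diag_form X (\<lambda>i. q * f i) v = q * diag_form X f v" for X f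
      by (simp add: diag_form_def sum_distrib_left mult.assoc)
    have "diag_form W0 (\<lambda>i. q * l i) v = (1 - t) * diag_form U (\<lambda>i. ln (a i powr q)) v
        + t * diag_form V (\<lambda>i. ln (b i powr q)) v"
      unfolding scale W0_def l_def Z_form[OF v] ln_powr by (simp add: scale distrib_left)
    also have "\<dots> \<le> diag_form (W q) (\<lambda>i. ln (d q i)) v"
      using concave_form_ln v by (auto simp: concave_form_def)
    finally show ?thesis .
  qed
  \<comment> \<open>Puts both means under the same outer map \<open>x powr (1 / p)\<close>, as the
    eigenvalue comparison requires.\<close>
  have F': "unitary_diag (F q) (W q) (\<lambda>i. (d q i powr (p / q)) powr (1 / p))" if "p \<noteq> 0" "q \<noteq> 0" for p q
    using F(1)[OF that(2)] that by (simp add: powr_powr)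
  have exp0: "unitary_diag (F 0) W0 (\<lambda>i. exp (q * l i / q))"
    and exp: "unitary_diag (F q) (W q) (\<lambda>i. exp (ln (d q i) / q))" if q: "q \<noteq> 0" for q
  proof -
    show "unitary_diag (F 0) W0 (\<lambda>i. exp (q * l i / q))" using F0(1) q by simp
    \<comment> \<open>The two functions of \<open>i\<close> are known to agree only for
      \<open>i < n\<close>, where \<open>d q i\<close> is positive, so the equality is stated for
      the matrices.\<close>
    have "mat_diag n (\<lambda>i. complex_of_real (d q i powr (1 / q)))
        = mat_diag n (\<lambda>i. complex_of_real (exp (ln (d q i) / q)))"
      using d[of q] by (intro eq_matI) (auto simp: mat_diag_def powr_def)
    then show "unitary_diag (F q) (W q) (\<lambda>i. exp (ln (d q i) / q))"
      using F(1)[OF q] unfolding unitary_diag_def carrier_matD(1)[OF F(2)[OF q]] by simp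
  qed
  have pos: "herm_eigval (F p) j \<le> herm_eigval (F q) j" if "0 < p" "p < q" for p q
    by (rule herm_eigval_mono[where g = "\<lambda>x. x powr (1 / p)" and S = "{0<..}",
          OF F(2) F(1) F(2) F' powr_le _ _ _ j])
      (use that d d_nonzero in \<open>auto intro!: mono_onI powr_mono2\<close>)
  \<comment> \<open>The exponents exchange roles: \<open>q / p\<close> lies between 0 and 1, and the
    outer map \<open>x powr (1 / q)\<close> is decreasing on positive numbers.\<close>
  have neg: "herm_eigval (F p) j \<le> herm_eigval (F q) j" if "p < q" "q < 0" for p q
    by (rule herm_eigval_antimono[where g = "\<lambda>x. x powr (1 / q)" and S = "{0<..}",
          OF F(2) F(1) F(2) F' powr_le _ _ _ j])
      (use that d d_nonzero in \<open>auto intro!: monotone_onI powr_mono2' simp: divide_simps\<close>)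
  have zero_pos: "herm_eigval (F 0) j \<le> herm_eigval (F q) j" if "0 < q" for q
    by (rule herm_eigval_mono[where g = "\<lambda>x. exp (x / q)" and S = UNIV, OF F0(2) exp0 F(2) exp ln_le _ _ _ j])
      (use that in \<open>auto intro!: mono_onI divide_right_mono\<close>)
  \<comment> \<open>The logarithmic comparison again, now with \<open>exp (x / p)\<close>, which is
    decreasing for negative \<open>p\<close>.\<close>
  have neg_zero: "herm_eigval (F p) j \<le> herm_eigval (F 0) j" if "p < 0" for p
    by (rule herm_eigval_antimono[where g = "\<lambda>x. exp (x / p)" and S = UNIV, OF F0(2) exp0 F(2) exp ln_le _ _ _ j])
      (use that in \<open>auto intro!: monotone_onI divide_right_mono_neg\<close>)
  show ?thesis
    unfolding F_def[symmetric]
  proof (rule monoI)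
    fix p q :: real assume "p \<le> q"
    then consider "p = q" | "0 < p" "p < q" | "p < q" "q < 0" | "p \<le> 0" "0 \<le> q" by linarith
    then show "herm_eigval (F p) j \<le> herm_eigval (F q) j"
    proof cases
      \<comment> \<open>Exponents on opposite sides of 0 are compared through the mean at 0.\<close>
      case 4
      have "herm_eigval (F p) j \<le> herm_eigval (F 0) j" using neg_zero 4 by (cases "p = 0") auto
      also have "\<dots> \<le> herm_eigval (F q) j" using zero_pos 4 by (cases "q = 0") auto
      finally show ?thesis .
    qed (use pos neg in auto)
  qed
qed

end
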